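(* Let $S$ be a topological semilattice, i.e. a topological semigroup that is commutative and satisfies $ss=s$ for every $s\in S$. Then $\mathcal{H}^2_{cb}(S)=0$.
   Context: A topological semigroup is a semigroup $S$ with a topology such that the multiplication $S\times S\to S$ is jointly continuous. For a topological space $X$, $\mathbf{C}(X)$ denotes the Banach space of all bounded continuous complex-valued functions on $X$ with the uniform norm. For a topological semigroup $S$ put $\mathcal{C}^0_{cb}(S)=\mathbb{C}$ and $\mathcal{C}^n_{cb}(S)=\mathbf{C}(S^n)$ for $n\ge1$. Let $\delta^0:\mathcal{C}^0_{cb}(S)\to\mathcal{C}^1_{cb}(S)$ be the zero map, and for $n\ge1$ let $\delta^n:\mathcal{C}^n_{cb}(S)\to\mathcal{C}^{n+1}_{cb}(S)$ be $$\delta^n(f)(s_1,\ldots,s_{n+1})=f(s_2,\ldots,s_{n+1})+\sum_{i=1}^n(-1)^if(s_1,\ldots,s_is_{i+1},\ldots,s_{n+1})+(-1)^{n+1}f(s_1,\ldots,s_n).$$ Then $\delta^{n+1}\delta^n=0$. The continuous bounded cohomology groups of $S$ are $\mathcal{H}^n_{cb}(S)=\ker\delta^n/\operatorname{Im}\delta^{n-1}$ (with $\operatorname{Im}\delta^{-1}=0$). *)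

theory Defs
  imports "HOL-Analysis.Analysis" "HOL-Algebra.Algebra"
begin

text \<open>
  A topological semigroup is a type of class \<open>topological_semigroup_mult\<close>, whose axiom is joint
  continuity of multiplication. A point \<open>(s\<^sub>1, \<dots>, s\<^sub>n)\<close> of the n-th power is a function on the
  index set \<open>{1..n}\<close>, extended by \<open>undefined\<close> off it.
\<close>

definition power_space :: "nat \<Rightarrow> (nat \<Rightarrow> 's::topological_space) topology"
  where "power_space n = product_topology (\<lambda>_. euclidean) {1..n}"

text \<open>
  Cochains are set to 0 outside the power space, so that equality of cochains is equality of
  functions. The 0-th power is a single point, which identifies the 0-cochains with the complex
  numbers. The pointwise addition is written as the multiplication of a \<open>monoid\<close> record, as
  the quotient construction \<open>Mod\<close> requires.
\<close>

definition cb_cochains :: "nat \<Rightarrow> ((nat \<Rightarrow> 's::topological_space) \<Rightarrow> complex) monoid"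
  where "cb_cochains n =
    \<lparr>carrier = {f. continuous_map (power_space n) euclidean f
                 \<and> bounded (f ` topspace (power_space n))
                 \<and> (\<forall>s. s \<notin> topspace (power_space n) \<longrightarrow> f s = 0)},
     mult = (\<lambda>f g s. f s + g s),
     one = (\<lambda>_. 0)\<rparr>"

definition merge_at :: "nat \<Rightarrow> nat \<Rightarrow> (nat \<Rightarrow> 's::times) \<Rightarrow> nat \<Rightarrow> 's"
  where "merge_at n i s =
    (\<lambda>j\<in>{1..n}. if j < i then s j else if j = i then s i * s (Suc i) else s (Suc j))"

definition cb_coboundary ::
    "nat \<Rightarrow> ((nat \<Rightarrow> 's::topological_semigroup_mult) \<Rightarrow> complex) \<Rightarrow> (nat \<Rightarrow> 's) \<Rightarrow> complex"
  where "cb_coboundary n f =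
    (if n = 0 then (\<lambda>_. 0)
     else (\<lambda>s. if s \<in> topspace (power_space (Suc n))
               then f (\<lambda>j\<in>{1..n}. s (Suc j))
                    + (\<Sum>i = 1..n. (-1) ^ i * f (merge_at n i s))
                    + (-1) ^ Suc n * f (restrict s {1..n})
               else 0))"

definition cb_cocycles :: "nat \<Rightarrow> ((nat \<Rightarrow> 's::topological_semigroup_mult) \<Rightarrow> complex) set"
  where "cb_cocycles n = kernel (cb_cochains n) (cb_cochains (Suc n)) (cb_coboundary n)"

definition cb_coboundaries :: "nat \<Rightarrow> ((nat \<Rightarrow> 's::topological_semigroup_mult) \<Rightarrow> complex) set"
  where "cb_coboundaries n =
    (case n of 0 \<Rightarrow> {\<lambda>_. 0} | Suc m \<Rightarrow> cb_coboundary m ` carrier (cb_cochains m))"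

definition cb_cohomology ::
    "'s::topological_semigroup_mult itself \<Rightarrow> nat \<Rightarrow> ((nat \<Rightarrow> 's) \<Rightarrow> complex) set monoid"
  where "cb_cohomology _ n =
    (cb_cochains n)\<lparr>carrier := cb_cocycles n\<rparr> Mod cb_coboundaries n"

end

theory Submission
  imports Defs
begin

text \<open>
  If a 2-cocycle \<open>f\<close> is the coboundary of \<open>g\<close>, that is
  \<open>f(s, t) = g(t) - g(st) + g(s)\<close>, then putting \<open>t = s\<close> and using \<open>ss = s\<close> forces
  \<open>g(s) = f(s, s)\<close>. So there is only one candidate, and it is bounded and continuous because it
  is the composite of \<open>f\<close> with the diagonal map; an averaging argument over the semigroup would
  not give continuity for free.

  The candidate works for the following reason. The cocycle identity at \<open>(s, s, u)\<close> reduces to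
  \<open>f(s, su) = f(s, s)\<close>. At \<open>(s, t, st)\<close> it reads
  \<open>f(t, st) - f(st, st) + f(s, st) - f(s, t) = 0\<close>. By commutativity the first and third terms
  are \<open>f(t, t)\<close> and \<open>f(s, s)\<close>, and the identity becomes
  \<open>f(s, t) = f(t, t) - f(st, st) + f(s, s)\<close>. This is
  \<open>semilattice_cocycle_eq_coboundary_of_diagonal\<close>.

  To read this as the vanishing of a quotient group, the cocycles have to form a group
  (\<open>group_hom_cb_coboundary\<close>) and the coboundaries have to be exactly the cocycles, which also
  takes the inclusion \<open>cb_coboundaries_2_subset_cocycles\<close>.
\<close>

section \<open>Cochain groups\<close>

lemma comm_group_cb_cochains: "comm_group (cb_cochains n)"
proof (rule comm_groupI)
  fix f :: "(nat \<Rightarrow> 's::topological_space) \<Rightarrow> complex"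
  assume "f \<in> carrier (cb_cochains n)"
  then have "(\<lambda>s. - f s) \<in> carrier (cb_cochains n)"
    by (auto simp: cb_cochains_def intro: continuous_map_minus)
  then show "\<exists>g\<in>carrier (cb_cochains n). g \<otimes>\<^bsub>cb_cochains n\<^esub> f = \<one>\<^bsub>cb_cochains n\<^esub>"
    by (rule rev_bexI) (simp add: cb_cochains_def)
qed (auto simp: cb_cochains_def algebra_simps image_constant_conv
    intro: continuous_map_add bounded_plus_comp)

lemma extend_by_zero_closed:
  assumes cont: "continuous_map (power_space n) euclidean h"
    and bdd: "bounded (h ` topspace (power_space n))"
  shows "(\<lambda>s. if s \<in> topspace (power_space n) then h s else 0) \<in> carrier (cb_cochains n)"
    (is "?h \<in> _")
proof -
  have "continuous_map (power_space n) euclidean ?h"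
    using cont by (rule continuous_map_eq) simp
  moreover have "?h ` topspace (power_space n) = h ` topspace (power_space n)"
    by simp
  ultimately show ?thesis
    using bdd by (simp add: cb_cochains_def)
qed

lemma continuous_map_semigroup_mult:
  fixes f g :: "'a \<Rightarrow> 's::topological_semigroup_mult"
  assumes "continuous_map T euclidean f" and "continuous_map T euclidean g"
  shows "continuous_map T euclidean (\<lambda>x. f x * g x)"
  using assms by (simp add: continuous_map_atin tendsto_mult)

lemma continuous_map_power_coordinate:
  assumes "i \<in> {1..n}"
  shows "continuous_map (power_space n) euclidean (\<lambda>s. s i)"
  using assms unfolding power_space_def by (rule continuous_map_product_projection)

lemma continuous_map_into_power_space:
  assumes "\<And>j. j \<in> {1..n} \<Longrightarrow> continuous_map T euclidean (\<lambda>x. h x j)"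
  shows "continuous_map T (power_space n) (\<lambda>x. \<lambda>j\<in>{1..n}. h x j)"
  unfolding power_space_def continuous_map_componentwise
  using assms by auto

text \<open>
  Joint continuity of the multiplication of the semigroup enters here, in the merged coordinate
  \<open>i\<close>; the other coordinates are projections.
\<close>

lemma continuous_map_merge_at:
  assumes "i \<in> {1..n}"
  shows "continuous_map (power_space (Suc n)) (power_space n)
           (merge_at n i :: (nat \<Rightarrow> 's::topological_semigroup_mult) \<Rightarrow> _)"
proof -
  have "continuous_map (power_space (Suc n)) euclidean
          (\<lambda>s :: nat \<Rightarrow> 's. if j < i then s j else if j = i then s i * s (Suc i) else s (Suc j))"
    if "j \<in> {1..n}" for j
    using that assms
    by (cases j i rule: linorder_cases)
       (auto intro!: continuous_map_semigroup_mult continuous_map_power_coordinate)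
  then show ?thesis
    unfolding merge_at_def by (rule continuous_map_into_power_space)
qed

text \<open>
  Every term of the coboundary is a pullback of this kind, along a continuous map between powers.
  The value of \<open>f (\<phi> s)\<close> off the power space is arbitrary, so the pullback becomes a cochain only
  through \<open>extend_by_zero_closed\<close>.
\<close>

lemma cb_cochain_pullback:
  assumes f: "f \<in> carrier (cb_cochains n)"
    and \<phi>: "continuous_map (power_space m) (power_space n) \<phi>"
  shows "continuous_map (power_space m) euclidean (\<lambda>s. f (\<phi> s))"
    and "bounded ((\<lambda>s. f (\<phi> s)) ` topspace (power_space m))"
proof -
  show "continuous_map (power_space m) euclidean (\<lambda>s. f (\<phi> s))"
    using f continuous_map_compose[OF \<phi>, of euclidean f] by (simp add: cb_cochains_def o_def)
  have "(\<lambda>s. f (\<phi> s)) ` topspace (power_space m) \<subseteq> f ` topspace (power_space n)"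
    using continuous_map_funspace[OF \<phi>] by auto
  then show "bounded ((\<lambda>s. f (\<phi> s)) ` topspace (power_space m))"
    by (rule bounded_subset[rotated]) (use f in \<open>simp add: cb_cochains_def\<close>)
qed

section \<open>The coboundary homomorphism\<close>

lemma bounded_sum_comp:
  fixes f :: "'i \<Rightarrow> 'a \<Rightarrow> 'b::real_normed_vector"
  assumes "\<And>i. i \<in> I \<Longrightarrow> bounded (f i ` S)"
  shows "bounded ((\<lambda>x. \<Sum>i\<in>I. f i x) ` S)"
  using assms
proof (induction I rule: infinite_finite_induct)
  case (insert i I)
  then show ?case by (simp add: bounded_plus_comp)
qed (auto simp: image_constant_conv)

lemma cb_coboundary_closed:
  fixes f :: "(nat \<Rightarrow> 's::topological_semigroup_mult) \<Rightarrow> complex"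
  assumes f: "f \<in> carrier (cb_cochains n)"
  shows "cb_coboundary n f \<in> carrier (cb_cochains (Suc n))"
proof (cases "n = 0")
  case True
  then show ?thesis by (auto simp: cb_coboundary_def cb_cochains_def image_constant_conv)
next
  case False
  let ?X = "power_space (Suc n) :: (nat \<Rightarrow> 's) topology"
  let ?d = "\<lambda>s. f (\<lambda>j\<in>{1..n}. s (Suc j)) + (\<Sum>i = 1..n. (-1) ^ i * f (merge_at n i s))
              + (-1) ^ Suc n * f (restrict s {1..n})"
  have tail: "continuous_map ?X (power_space n) (\<lambda>s. \<lambda>j\<in>{1..n}. s (Suc j))"
    by (rule continuous_map_into_power_space) (rule continuous_map_power_coordinate, auto)
  have init: "continuous_map ?X (power_space n) (\<lambda>s. restrict s {1..n})"
    by (rule continuous_map_into_power_space) (rule continuous_map_power_coordinate, auto)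
  have scale: "continuous_map ?X euclidean (\<lambda>s. c * h s) \<and> bounded ((\<lambda>s. c * h s) ` topspace ?X)"
    if "continuous_map ?X euclidean h" "bounded (h ` topspace ?X)" for h and c :: complex
    using that bounded_linear_image[OF that(2) bounded_linear_mult_right[of c]]
    by (auto simp: image_image intro: continuous_map_semigroup_mult)
  have "continuous_map ?X euclidean ?d"
    by (intro continuous_map_add continuous_map_sum finite_atLeastAtMost
          scale[THEN conjunct1] cb_cochain_pullback[OF f] tail init continuous_map_merge_at)
  moreover have "bounded (?d ` topspace ?X)"
    by (intro bounded_plus_comp bounded_sum_comp
          scale[THEN conjunct2] cb_cochain_pullback[OF f] tail init continuous_map_merge_at)
  ultimately show ?thesis
    using False extend_by_zero_closed[of "Suc n" ?d] by (simp add: cb_coboundary_def)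
qed

lemma group_hom_cb_coboundary:
  "group_hom (cb_cochains n) (cb_cochains (Suc n))
     (cb_coboundary n :: ((nat \<Rightarrow> 's::topological_semigroup_mult) \<Rightarrow> complex) \<Rightarrow> _)"
proof -
  have "cb_coboundary n (\<lambda>s. f s + g s) = (\<lambda>s. cb_coboundary n f s + cb_coboundary n g s)"
    for f g :: "(nat \<Rightarrow> 's) \<Rightarrow> complex"
    by (auto simp: cb_coboundary_def fun_eq_iff algebra_simps sum.distrib)
  then have "cb_coboundary n \<in> hom (cb_cochains n) (cb_cochains (Suc n) :: ((nat \<Rightarrow> 's) \<Rightarrow> _) monoid)"
    by (intro homI cb_coboundary_closed) (auto simp: cb_cochains_def)
  then show ?thesis
    by (intro group_hom.intro group_hom_axioms.intro comm_group.axioms(2) comm_group_cb_cochains)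
qed

section \<open>Low-degree coboundaries in coordinates\<close>

text \<open>
  Writing points as lists turns the index computations of low-degree coboundaries into the
  familiar formulas in \<open>s\<close>, \<open>t\<close>, \<open>u\<close>. Coordinates start at 1 and lists at 0, hence the shift.
\<close>

definition tuple :: "'s list \<Rightarrow> nat \<Rightarrow> 's"
  where "tuple xs = (\<lambda>j\<in>{1..length xs}. xs ! (j - 1))"

lemma topspace_power_space: "topspace (power_space n) = tuple ` {xs. length xs = n}"
proof (intro equalityI subsetI)
  fix s :: "nat \<Rightarrow> 's::topological_space"
  assume "s \<in> topspace (power_space n)"
  then have "s = tuple (map (\<lambda>i. s (Suc i)) [0..<n])"
    by (auto simp: power_space_def tuple_def PiE_iff extensional_def fun_eq_iff)
  then show "s \<in> tuple ` {xs. length xs = n}"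
    by (rule image_eqI) simp
qed (auto simp: power_space_def tuple_def)

lemma tuple_in_power_space [simp]: "length xs = n \<Longrightarrow> tuple xs \<in> topspace (power_space n)"
  by (simp add: topspace_power_space)

lemma cochain_eqI:
  assumes "f \<in> carrier (cb_cochains n)" and "g \<in> carrier (cb_cochains n)"
    and "\<And>xs. length xs = n \<Longrightarrow> f (tuple xs) = g (tuple xs)"
  shows "f = g"
proof
  fix s
  show "f s = g s"
    using assms by (cases "s \<in> topspace (power_space n)")
      (auto simp: topspace_power_space cb_cochains_def)
qed

lemma cb_coboundary_1:
  "cb_coboundary 1 g (tuple [s, t]) = g (tuple [t]) - g (tuple [s * t]) + g (tuple [s])"
proof -
  have "(\<lambda>j\<in>{1..1}. tuple [s, t] (Suc j)) = tuple [t]" "merge_at 1 1 (tuple [s, t]) = tuple [s * t]"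
    "restrict (tuple [s, t]) {1..1} = tuple [s]"
    by (auto simp: tuple_def merge_at_def fun_eq_iff)
  then show ?thesis by (simp add: cb_coboundary_def)
qed

lemma cb_coboundary_2:
  "cb_coboundary 2 f (tuple [s, t, u]) =
     f (tuple [t, u]) - f (tuple [s * t, u]) + f (tuple [s, t * u]) - f (tuple [s, t])"
proof -
  have two: "{1..2} = {1, 2::nat}" by auto
  have "(\<lambda>j\<in>{1..2}. tuple [s, t, u] (Suc j)) = tuple [t, u]"
    "merge_at 2 1 (tuple [s, t, u]) = tuple [s * t, u]"
    "merge_at 2 2 (tuple [s, t, u]) = tuple [s, t * u]"
    "restrict (tuple [s, t, u]) {1..2} = tuple [s, t]"
    by (auto simp: tuple_def merge_at_def two fun_eq_iff nth_Cons')
  moreover have "(\<Sum>i = 1..2. (-1) ^ i * f (merge_at 2 i (tuple [s, t, u]))) =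
      f (merge_at 2 2 (tuple [s, t, u])) - f (merge_at 2 1 (tuple [s, t, u]))"
    unfolding two by simp
  ultimately show ?thesis by (simp add: cb_coboundary_def)
qed

lemma length_2_3_conv:
  "length xs = 2 \<longleftrightarrow> (\<exists>s t. xs = [s, t])" "length xs = 3 \<longleftrightarrow> (\<exists>s t u. xs = [s, t, u])"
  by (auto simp: numeral_eq_Suc length_Suc_conv)

lemma cb_cocycles_2_iff:
  "f \<in> cb_cocycles 2 \<longleftrightarrow> f \<in> carrier (cb_cochains 2) \<and>
     (\<forall>s t u. f (tuple [t, u]) - f (tuple [s * t, u]) + f (tuple [s, t * u]) - f (tuple [s, t]) = 0)"
proof -
  have "cb_coboundary 2 f = (\<lambda>_. 0) \<longleftrightarrow> (\<forall>s t u. cb_coboundary 2 f (tuple [s, t, u]) = 0)"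
    if "f \<in> carrier (cb_cochains 2)"
  proof (intro iffI)
    assume "\<forall>s t u. cb_coboundary 2 f (tuple [s, t, u]) = 0"
    then show "cb_coboundary 2 f = (\<lambda>_. 0)"
      using cb_coboundary_closed[OF that]
      by (intro cochain_eqI[of _ 3])
         (auto simp: length_2_3_conv cb_cochains_def image_constant_conv)
  qed simp
  then show ?thesis
    by (auto simp: cb_cocycles_def kernel_def cb_coboundary_2) (auto simp: cb_cochains_def)
qed

text \<open>
  Substituting the formula for a coboundary into the cocycle identity leaves terms that cancel in
  pairs, the two values of \<open>g\<close> at triple products by associativity.
\<close>

lemma cb_coboundaries_2_subset_cocycles: "cb_coboundaries 2 \<subseteq> cb_cocycles 2"
proof
  fix f :: "(nat \<Rightarrow> 's::topological_semigroup_mult) \<Rightarrow> complex"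
  assume "f \<in> cb_coboundaries 2"
  then obtain g where "g \<in> carrier (cb_cochains 1)" and "f = cb_coboundary 1 g"
    by (auto simp: cb_coboundaries_def numeral_2_eq_2)
  then show "f \<in> cb_cocycles 2"
    using cb_coboundary_closed[of g 1, unfolded Suc_1]
    by (simp add: cb_cocycles_2_iff cb_coboundary_1[simplified] mult.assoc)
qed

section \<open>Cocycles on a semilattice\<close>

text \<open>
  The pullback along \<open>s \<mapsto> (s, s)\<close>, the only possible primitive of a cocycle \<open>f\<close>.
\<close>

definition diagonal_cochain :: "((nat \<Rightarrow> 's::topological_space) \<Rightarrow> complex) \<Rightarrow> (nat \<Rightarrow> 's) \<Rightarrow> complex"
  where "diagonal_cochain f =
    (\<lambda>x. if x \<in> topspace (power_space 1) then f (\<lambda>j\<in>{1..2}. x 1) else 0)"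

lemma diagonal_cochain_tuple [simp]: "diagonal_cochain f (tuple [s]) = f (tuple [s, s])"
proof -
  have "(\<lambda>j\<in>{1..2}. tuple [s] 1) = tuple [s, s]"
    by (auto simp: tuple_def fun_eq_iff nth_Cons')
  then show ?thesis by (simp add: diagonal_cochain_def)
qed

lemma diagonal_cochain_closed:
  assumes f: "f \<in> carrier (cb_cochains 2)"
  shows "diagonal_cochain f \<in> carrier (cb_cochains 1)"
proof -
  have "continuous_map (power_space 1) (power_space 2) (\<lambda>x. \<lambda>j\<in>{1..2}. x 1)"
    by (rule continuous_map_into_power_space) (rule continuous_map_power_coordinate, simp)
  from extend_by_zero_closed[OF cb_cochain_pullback[OF f this]] show ?thesis
    by (simp add: diagonal_cochain_def)
qed

text \<open>
  Two instances of the cocycle identity suffice: \<open>(s, s, t)\<close>, which evaluates \<open>f\<close> at a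
  comparable pair \<open>(s, st)\<close>, and \<open>(s, t, st)\<close>, which reduces the general pair \<open>(s, t)\<close> to
  comparable ones.
\<close>

lemma semilattice_cocycle_eq_coboundary_of_diagonal:
  assumes commutative: "\<And>s t :: 's::topological_semigroup_mult. s * t = t * s"
    and idempotent: "\<And>s :: 's. s * s = s"
    and f: "f \<in> (cb_cocycles 2 :: ((nat \<Rightarrow> 's) \<Rightarrow> complex) set)"
  shows "f = cb_coboundary 1 (diagonal_cochain f)"
proof -
  have cochain: "f \<in> carrier (cb_cochains 2)"
    and cocycle: "f (tuple [t, u]) - f (tuple [s * t, u]) + f (tuple [s, t * u]) - f (tuple [s, t]) = 0"
    for s t u
    using f by (auto simp: cb_cocycles_2_iff)
  \<comment> \<open>At \<open>(s, s, t)\<close> the terms \<open>f(s, t)\<close> and \<open>f(ss, t)\<close> cancel.\<close>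
  have absorb: "f (tuple [s, s * t]) = f (tuple [s, s])" for s t
    using cocycle[where s = s and t = s and u = t] idempotent[of s] by simp
  have formula: "f (tuple [s, t]) = f (tuple [t, t]) - f (tuple [s * t, s * t]) + f (tuple [s, s])" for s t
  proof -
    have "t * (s * t) = s * t"
      by (metis commutative idempotent mult.assoc)
    moreover have "f (tuple [t, s * t]) = f (tuple [t, t])"
      using absorb[of t s] commutative[of t s] by simp
    ultimately show ?thesis
      using cocycle[where s = s and t = t and u = "s * t"] absorb[of s t] by (simp add: algebra_simps)
  qed
  show ?thesis
    using cochain cb_coboundary_closed[OF diagonal_cochain_closed[OF cochain], unfolded Suc_1]
  proof (rule cochain_eqI)
    fix xs :: "'s list"
    assume "length xs = 2"
    then obtain s t where "xs = [s, t]"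
      by (auto simp: length_2_3_conv)
    then show "f (tuple xs) = cb_coboundary 1 (diagonal_cochain f) (tuple xs)"
      using formula[of s t] by (simp add: cb_coboundary_1[simplified])
  qed
qed

lemma (in group) trivial_group_self_factor: "trivial_group (G Mod carrier G)"
proof -
  have "group (G Mod carrier G)"
    by (intro normal.factorgroup_is_group normal_invI subgroup_self) auto
  moreover have "carrier (G Mod carrier G) = {carrier G}"
    using one_closed by (auto simp: FactGroup_def RCOSETS_def coset_join2[OF _ subgroup_self])
  ultimately show ?thesis
    by (simp add: trivial_group_def FactGroup_def)
qed

theorem theorem5p1:
  assumes commutative: "\<And>s t :: 's::topological_semigroup_mult. s * t = t * s"
    and idempotent: "\<And>s :: 's. s * s = s"
  shows "trivial_group (cb_cohomology TYPE('s) 2)"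
proof -
  let ?Z = "cb_cocycles 2 :: ((nat \<Rightarrow> 's) \<Rightarrow> complex) set"
  let ?G = "(cb_cochains 2)\<lparr>carrier := ?Z\<rparr>"
  have "f \<in> cb_coboundaries 2" if "f \<in> ?Z" for f
  proof -
    have "diagonal_cochain f \<in> carrier (cb_cochains 1)"
      using that by (intro diagonal_cochain_closed) (simp add: cb_cocycles_2_iff)
    then show ?thesis
      using semilattice_cocycle_eq_coboundary_of_diagonal[OF commutative idempotent that]
      by (auto simp: cb_coboundaries_def numeral_2_eq_2)
  qed
  then have "cb_coboundaries 2 = ?Z"
    using cb_coboundaries_2_subset_cocycles by blast
  moreover have "group ?G"
    unfolding cb_cocycles_def
    by (intro group.subgroup_imp_group comm_group.axioms(2) comm_group_cb_cochains
          group_hom.subgroup_kernel group_hom_cb_coboundary)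
  ultimately show ?thesis
    using group.trivial_group_self_factor[of ?G] by (simp add: cb_cohomology_def)
qed

end
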